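(* There exist a Hilbert space $H$, a unitary operator $B\in B(H)$ and a self-adjoint (possibly unbounded) operator $T$ with domain $D(T)\subset H$ such that $BT\subset TB^*$ but $B^*T\not\subset TB$.
   Context: $H$ is a complex Hilbert space and $B(H)$ denotes the bounded everywhere-defined linear operators on $H$. For operators $R,S$ in $H$, $R\subset S$ means $D(R)\subset D(S)$ and $Rx=Sx$ for all $x\in D(R)$; products carry their natural domains, $D(RS)=\{x\in D(S): Sx\in D(R)\}$. *)

theory Defs
  imports "HOL-Analysis.Analysis" "HOL-Algebra.Module"
begin

section \<open>Complex Hilbert spaces\<close>

text \<open>
  The distribution has no complex inner product spaces, so they are built here on the modules of
  HOL-Algebra. A space is a record with an explicit carrier, hence a statement can quantify
  existentially over spaces; over the element type \<^typ>\<open>nat \<Rightarrow> complex\<close> this covers, up to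
  isomorphism, every separable Hilbert space. The multiplicative part inherited from the ring record is irrelevant.
\<close>

definition complex_ring :: "complex ring" where
  "complex_ring = \<lparr>carrier = UNIV, mult = (*), one = 1, zero = 0, add = (+)\<rparr>"

record 'a cinner_space = "(complex, 'a) module" +
  cinner :: "'a \<Rightarrow> 'a \<Rightarrow> complex" (\<open>\<langle>_, _\<rangle>\<index>\<close>)

definition cnorm :: "'a cinner_space \<Rightarrow> 'a \<Rightarrow> real" where
  "cnorm H x = sqrt (Re \<langle>x, x\<rangle>\<^bsub>H\<^esub>)"

text \<open>The value off the carrier is a dummy: \<^locale>\<open>Metric_space\<close> requires a metric to be
  nonnegative and symmetric on the whole type.\<close>

definition cdist :: "'a cinner_space \<Rightarrow> 'a \<Rightarrow> 'a \<Rightarrow> real" where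
  "cdist H x y = (if x \<in> carrier H \<and> y \<in> carrier H then cnorm H (x \<ominus>\<^bsub>H\<^esub> y) else 0)"

text \<open>The inner product is linear in its first argument.\<close>

locale complex_inner_product_space = Module.module complex_ring H
  for H :: "'a cinner_space" (structure) +
  assumes cinner_add:
      "\<lbrakk>x \<in> carrier H; y \<in> carrier H; z \<in> carrier H\<rbrakk> \<Longrightarrow> \<langle>x \<oplus> y, z\<rangle> = \<langle>x, z\<rangle> + \<langle>y, z\<rangle>"
    and cinner_smult:
      "\<lbrakk>x \<in> carrier H; y \<in> carrier H\<rbrakk> \<Longrightarrow> \<langle>c \<odot> x, y\<rangle> = c * \<langle>x, y\<rangle>"
    and cinner_cnj:
      "\<lbrakk>x \<in> carrier H; y \<in> carrier H\<rbrakk> \<Longrightarrow> \<langle>y, x\<rangle> = cnj \<langle>x, y\<rangle>"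
    and cinner_pos:
      "\<lbrakk>x \<in> carrier H; x \<noteq> \<zero>\<rbrakk> \<Longrightarrow> 0 < Re \<langle>x, x\<rangle>"

text \<open>Hence the notions of \<^locale>\<open>Metric_space\<close> used for completeness and density apply.\<close>

context complex_inner_product_space
begin

lemma carrier_complex_ring [simp]: "c \<in> carrier complex_ring"
  by (simp add: complex_ring_def)

lemma cinner_zero [simp]: "x \<in> carrier H \<Longrightarrow> \<langle>\<zero>, x\<rangle> = 0"
  using cinner_add[of \<zero> \<zero> x] by simp

lemma cinner_add_right:
  "\<lbrakk>x \<in> carrier H; y \<in> carrier H; z \<in> carrier H\<rbrakk> \<Longrightarrow> \<langle>z, x \<oplus> y\<rangle> = \<langle>z, x\<rangle> + \<langle>z, y\<rangle>"
  by (metis M.a_closed cinner_add cinner_cnj complex_cnj_add)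

lemma cinner_smult_right:
  "\<lbrakk>x \<in> carrier H; y \<in> carrier H\<rbrakk> \<Longrightarrow> \<langle>x, c \<odot> y\<rangle> = cnj c * \<langle>x, y\<rangle>"
  by (metis carrier_complex_ring cinner_cnj cinner_smult complex_cnj_mult smult_closed)

lemma cinner_self_nonneg: "x \<in> carrier H \<Longrightarrow> 0 \<le> Re \<langle>x, x\<rangle>"
  by (cases "x = \<zero>") (auto dest: cinner_pos)

lemma cnorm_add_le:
  assumes x: "x \<in> carrier H" and y: "y \<in> carrier H"
  shows "cnorm H (x \<oplus> y) \<le> cnorm H x + cnorm H y"
proof -
  define a where "a = Re \<langle>x, x\<rangle>"
  define b where "b = Re \<langle>y, y\<rangle>"
  define r where "r = Re \<langle>x, y\<rangle>"
  have ab: "0 \<le> a" "0 \<le> b"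
    using cinner_self_nonneg x y by (auto simp: a_def b_def)
  have r': "Re \<langle>y, x\<rangle> = r"
    using cinner_cnj[OF x y] by (simp add: r_def)
  have pos: "0 \<le> a + 2 * t * r + t\<^sup>2 * b" for t :: real
  proof -
    let ?z = "complex_of_real t \<odot> y"
    have z: "?z \<in> carrier H" using y by simp
    have "\<langle>x \<oplus> ?z, x \<oplus> ?z\<rangle> = \<langle>x, x\<rangle> + t * \<langle>x, y\<rangle> + (t * \<langle>y, x\<rangle> + t * (t * \<langle>y, y\<rangle>))"
      using x y z by (simp add: cinner_add cinner_add_right cinner_smult cinner_smult_right
          distrib_left)
    then have "Re \<langle>x \<oplus> ?z, x \<oplus> ?z\<rangle> = a + 2 * t * r + t\<^sup>2 * b"
      by (simp add: a_def b_def r_def r'[unfolded r_def] power2_eq_square algebra_simps)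
    then show ?thesis
      using cinner_self_nonneg[of "x \<oplus> ?z"] x z by simp
  qed
  have "r\<^sup>2 \<le> a * b"
  proof (cases "b = 0")
    case True
    have "r = 0"
    proof (rule ccontr)
      assume "r \<noteq> 0"
      with pos[of "- (a + 1) / (2 * r)"] True show False by (simp add: field_simps)
    qed
    then show ?thesis using True by simp
  next
    case False
    then have b: "0 < b" using ab by simp
    have "0 \<le> b * (a + 2 * (- r / b) * r + (- r / b)\<^sup>2 * b)"
      using pos[of "- r / b"] b by simp
    also have "\<dots> = a * b - r\<^sup>2"
      using b by (simp add: field_simps power2_eq_square)
    finally show ?thesis by simp
  qed
  then have "r \<le> sqrt a * sqrt b"
    by (metis real_sqrt_le_mono real_sqrt_mult real_sqrt_abs abs_ge_self order_trans)
  then have "a + 2 * r + b \<le> (sqrt a + sqrt b)\<^sup>2"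
    using ab by (simp add: power2_sum)
  then have "sqrt (a + 2 * r + b) \<le> sqrt a + sqrt b"
    by (rule real_le_lsqrt[rotated]) (use ab in simp)
  moreover have "Re \<langle>x \<oplus> y, x \<oplus> y\<rangle> = a + 2 * r + b"
    using x y r' by (simp add: cinner_add cinner_add_right a_def b_def r_def)
  ultimately show ?thesis by (simp add: cnorm_def a_def b_def)
qed

lemma cnorm_minus_commute:
  assumes x: "x \<in> carrier H" and y: "y \<in> carrier H"
  shows "cnorm H (x \<ominus> y) = cnorm H (y \<ominus> x)"
proof -
  have inv: "\<langle>\<ominus> u, \<ominus> u\<rangle> = \<langle>u, u\<rangle>" if u: "u \<in> carrier H" for u
  proof -
    have 1: "\<langle>\<ominus> u, v\<rangle> = - \<langle>u, v\<rangle>" if "v \<in> carrier H" for v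
      using cinner_add[of "\<ominus> u" u v] u that by (simp add: M.l_neg eq_neg_iff_add_eq_0)
    have "\<langle>u, \<ominus> u\<rangle> = - \<langle>u, u\<rangle>"
      using cinner_cnj[of "\<ominus> u" u] cinner_cnj[of u u] 1[OF u] u by simp
    then show ?thesis using 1 u by simp
  qed
  have "y \<ominus> x = \<ominus> (x \<ominus> y)"
    using x y by (simp add: M.minus_eq M.minus_add M.a_comm)
  then show ?thesis
    using inv x y by (simp add: cnorm_def)
qed

sublocale Metric_space "carrier H" "cdist H"
proof
  show "0 \<le> cdist H x y" for x y
    by (auto simp: cdist_def cnorm_def cinner_self_nonneg)
  show "cdist H x y = cdist H y x" for x y
    by (auto simp: cdist_def cnorm_minus_commute)
  show "cdist H x y = 0 \<longleftrightarrow> x = y" if xy: "x \<in> carrier H" "y \<in> carrier H" for x y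
  proof -
    have "cdist H x y = 0 \<longleftrightarrow> x \<ominus> y = \<zero>"
      using xy cinner_pos[of "x \<ominus> y"]
      by (cases "x \<ominus> y = \<zero>") (simp_all add: cdist_def cnorm_def)
    also have "x \<ominus> y = \<zero> \<longleftrightarrow> x = y"
      using xy by (metis M.minus_closed M.minus_eq M.r_neg M.minus_equality M.minus_minus M.a_inv_closed)
    finally show ?thesis .
  qed
  show "cdist H x z \<le> cdist H x y + cdist H y z"
    if "x \<in> carrier H" "y \<in> carrier H" "z \<in> carrier H" for x y z
  proof -
    have "x \<ominus> z = (x \<ominus> y) \<oplus> (y \<ominus> z)"
      using that by (simp add: M.minus_eq M.a_assoc M.r_neg1)
    then show ?thesis
      using cnorm_add_le[of "x \<ominus> y" "y \<ominus> z"] that by (simp add: cdist_def)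
  qed
qed

end

locale complex_hilbert_space = complex_inner_product_space +
  assumes complete: "mcomplete"

section \<open>Operators\<close>

text \<open>An operator is a domain together with a function whose values off the domain are irrelevant;
  equality of operators is therefore \<open>op_eq\<close>, not HOL equality of records.\<close>

record 'a operator =
  opdom :: "'a set"
  opfun :: "'a \<Rightarrow> 'a"

definition op_le :: "'a operator \<Rightarrow> 'a operator \<Rightarrow> bool" where
  "op_le R S \<longleftrightarrow> opdom R \<subseteq> opdom S \<and> (\<forall>x\<in>opdom R. opfun R x = opfun S x)"

definition op_eq :: "'a operator \<Rightarrow> 'a operator \<Rightarrow> bool" where
  "op_eq R S \<longleftrightarrow> op_le R S \<and> op_le S R"

definition op_comp :: "'a operator \<Rightarrow> 'a operator \<Rightarrow> 'a operator" where
  "op_comp R S = \<lparr>opdom = {x \<in> opdom S. opfun S x \<in> opdom R}, opfun = (\<lambda>x. opfun R (opfun S x))\<rparr>"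

definition op_id :: "'a cinner_space \<Rightarrow> 'a operator" where
  "op_id H = \<lparr>opdom = carrier H, opfun = (\<lambda>x. x)\<rparr>"

definition linear_operator :: "'a cinner_space \<Rightarrow> 'a operator \<Rightarrow> bool" where
  "linear_operator H T \<longleftrightarrow>
     submodule (opdom T) complex_ring H \<and>
     opfun T \<in> opdom T \<rightarrow> carrier H \<and>
     (\<forall>x\<in>opdom T. \<forall>y\<in>opdom T. opfun T (x \<oplus>\<^bsub>H\<^esub> y) = opfun T x \<oplus>\<^bsub>H\<^esub> opfun T y) \<and>
     (\<forall>c. \<forall>x\<in>opdom T. opfun T (c \<odot>\<^bsub>H\<^esub> x) = c \<odot>\<^bsub>H\<^esub> opfun T x)"

definition bounded_operators :: "'a cinner_space \<Rightarrow> 'a operator set" where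
  "bounded_operators H = {T. linear_operator H T \<and> opdom T = carrier H \<and>
     (\<exists>K. \<forall>x\<in>carrier H. cnorm H (opfun T x) \<le> K * cnorm H x)}"

definition densely_defined :: "'a cinner_space \<Rightarrow> 'a operator \<Rightarrow> bool" where
  "densely_defined H T \<longleftrightarrow>
     Metric_space.mtopology (carrier H) (cdist H) closure_of opdom T = carrier H"

text \<open>The vector \<open>z\<close> below is unique exactly when \<open>T\<close> is densely defined, so \<open>op_adjoint\<close> is meaningful
  only for such \<open>T\<close>.\<close>

definition op_adjoint :: "'a cinner_space \<Rightarrow> 'a operator \<Rightarrow> 'a operator" where
  "op_adjoint H T =
     \<lparr>opdom = {y \<in> carrier H. \<exists>z\<in>carrier H. \<forall>x\<in>opdom T. \<langle>opfun T x, y\<rangle>\<^bsub>H\<^esub> = \<langle>x, z\<rangle>\<^bsub>H\<^esub>},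
      opfun = (\<lambda>y. THE z. z \<in> carrier H \<and> (\<forall>x\<in>opdom T. \<langle>opfun T x, y\<rangle>\<^bsub>H\<^esub> = \<langle>x, z\<rangle>\<^bsub>H\<^esub>))\<rparr>"

definition self_adjoint :: "'a cinner_space \<Rightarrow> 'a operator \<Rightarrow> bool" where
  "self_adjoint H T \<longleftrightarrow> linear_operator H T \<and> densely_defined H T \<and> op_eq (op_adjoint H T) T"

definition unitary :: "'a cinner_space \<Rightarrow> 'a operator \<Rightarrow> bool" where
  "unitary H B \<longleftrightarrow> B \<in> bounded_operators H \<and>
     op_eq (op_comp (op_adjoint H B) B) (op_id H) \<and> op_eq (op_comp B (op_adjoint H B)) (op_id H)"

end

theory Submission
  imports Defs
begin

text \<open>
  On \<open>\<ell>\<^sup>2(\<int>)\<close>, let \<open>T\<close> multiply the \<open>n\<close>-th coordinate by \<open>4\<^sup>n\<close>, on its maximal domain, and let \<open>B\<close> be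
  convolution with a summable sequence \<open>b\<close>. Reading \<open>x\<close> as the boundary function \<open>f(z) = \<Sum> x\<^sub>n z\<^sup>n\<close> on the unit
  circle, \<open>T\<close> is the substitution \<open>f(z) \<mapsto> f(4 z)\<close>, defined for those \<open>f\<close> that continue to the annulus
  \<open>1 < |z| < 4\<close>, and \<open>B\<close> is multiplication by \<open>\<beta>(z) = \<Sum> b\<^sub>j z\<^sup>j\<close>. If \<open>\<beta>\<close> is unimodular on the circle, then
  \<open>B\<close> is unitary and \<open>B\<^sup>*\<close> is multiplication by \<open>1 / \<beta>\<close>. The inclusion \<open>B T \<subset> T B\<^sup>*\<close> now asks that \<open>1 / \<beta>\<close>
  continue to the annulus with boundary values \<open>(1 / \<beta>)(4 z) = \<beta>(z)\<close>, while \<open>B\<^sup>* T \<subset> T B\<close> would need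
  \<open>\<beta>\<close> itself to continue there. So a function \<open>\<beta>\<close> with a pole in the annulus, where \<open>1 / \<beta>\<close> has none, separates
  the two inclusions.

  These conditions give \<open>\<beta>(16 z) = \<beta>(z)\<close>, which leads to elliptic functions of \<open>log z\<close>. One of them, of
  degree two, has the explicit Laurent coefficients
  \<open>b\<^sub>j = \<i> c 2\<^sup>j / (4\<^sup>j - 4\<^sup>-\<^sup>j)\<close> for odd \<open>j\<close> and \<open>b\<^sub>j = 0\<close> for even \<open>j\<close>, which decay like \<open>2\<^sup>-\<^sup>j\<close> as \<open>j \<rightarrow> \<infinity>\<close>:
  the poles nearest to the unit circle from outside have modulus \<open>2\<close>. With these coefficients everything can be
  checked on sequences, without function theory.

  \<^item> Unitarity is the orthonormality of the translates of \<open>b\<close> (\<open>symbol_orthonormal\<close>). By partial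
    fractions, each product \<open>b\<^sub>j b\<^sub>j\<^sub>+\<^sub>a\<close> with \<open>a \<noteq> 0\<close> is a combination of one odd summable sequence and its
    translate (\<open>symbol_coeff_telescope\<close>), and an odd sequence sums to zero.
  \<^item> The relation between \<open>\<beta>\<close> and \<open>1 / \<beta>\<close> is \<open>4\<^sup>j cnj b\<^sub>-\<^sub>j = b\<^sub>j\<close> (\<open>four_powi_symbol_uminus\<close>). It
    makes \<open>T B\<^sup>* x\<close> and \<open>B T x\<close> equal coordinate by coordinate for every \<open>x\<close>, so \<open>B\<^sup>* x\<close> lies in the domain of
    \<open>T\<close> as soon as \<open>T x\<close> is square summable.
  \<^item> The pole shows up as \<open>4\<^sup>j |b\<^sub>j| \<ge> c 2\<^sup>j\<close> for odd \<open>j > 0\<close>, so \<open>B\<close> takes the unit vector \<open>e\<^sub>0\<close>, which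
    lies in the domain of \<open>T\<close>, out of that domain (\<open>four_powi_symbol_not_square_summable\<close>).
\<close>

section \<open>The Hilbert space of square summable families\<close>

definition square_summable :: "('i \<Rightarrow> complex) set" where
  "square_summable = {x. (\<lambda>i. (cmod (x i))\<^sup>2) summable_on UNIV}"

definition ell2 :: "('i \<Rightarrow> complex) cinner_space" where
  "ell2 = \<lparr>carrier = square_summable, mult = (\<lambda>x y i. x i * y i), one = (\<lambda>i. 1),
     zero = (\<lambda>i. 0), add = (\<lambda>x y i. x i + y i), smult = (\<lambda>c x i. c * x i),
     cinner = (\<lambda>x y. \<Sum>\<^sub>\<infinity>i. x i * cnj (y i))\<rparr>"

lemma ell2_simps [simp]:
  "carrier ell2 = square_summable"
  "\<zero>\<^bsub>ell2\<^esub> = (\<lambda>i. 0)"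
  "x \<oplus>\<^bsub>ell2\<^esub> y = (\<lambda>i. x i + y i)"
  "c \<odot>\<^bsub>ell2\<^esub> x = (\<lambda>i. c * x i)"
  by (simp_all add: ell2_def)

lemma cinner_ell2: "cinner ell2 x y = (\<Sum>\<^sub>\<infinity>i. x i * cnj (y i))"
  by (simp add: ell2_def)

lemma square_summable_zero [simp]: "(\<lambda>i. 0) \<in> square_summable"
  by (simp add: square_summable_def)

lemma square_summable_scale [simp]:
  "x \<in> square_summable \<Longrightarrow> (\<lambda>i. c * x i) \<in> square_summable"
  by (simp add: square_summable_def norm_mult power_mult_distrib summable_on_cmult_right)

lemma square_summable_uminus [simp]:
  "x \<in> square_summable \<Longrightarrow> (\<lambda>i. - x i) \<in> square_summable"
  by (simp add: square_summable_def)

lemma cmod_add_square_le: "(cmod (a + b))\<^sup>2 \<le> 2 * (cmod a)\<^sup>2 + 2 * (cmod b)\<^sup>2"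
proof -
  have "(cmod (a + b))\<^sup>2 \<le> (cmod a + cmod b)\<^sup>2"
    by (intro power_mono norm_triangle_ineq) simp
  also have "\<dots> \<le> 2 * (cmod a)\<^sup>2 + 2 * (cmod b)\<^sup>2"
    using sum_squares_bound[of "cmod a" "cmod b"] by (simp add: power2_sum)
  finally show ?thesis .
qed

lemma square_summable_add [simp]:
  assumes "x \<in> square_summable" "y \<in> square_summable"
  shows "(\<lambda>i. x i + y i) \<in> square_summable"
proof -
  have "(\<lambda>i. 2 * (cmod (x i))\<^sup>2 + 2 * (cmod (y i))\<^sup>2) summable_on UNIV"
    using assms by (intro summable_on_add summable_on_cmult_right) (auto simp: square_summable_def)
  then show ?thesis
    unfolding square_summable_def mem_Collect_eq
    by (rule summable_on_comparison_test) (auto intro: cmod_add_square_le)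
qed

lemma square_summable_diff [simp]:
  "x \<in> square_summable \<Longrightarrow> y \<in> square_summable \<Longrightarrow> (\<lambda>i. x i - y i) \<in> square_summable"
  using square_summable_add[of x "\<lambda>i. - y i"] by simp

lemma square_summable_finite_support:
  assumes "finite F"
  shows "(\<lambda>i. if i \<in> F then x i else 0) \<in> square_summable"
  unfolding square_summable_def mem_Collect_eq
  by (rule finite_nonzero_values_imp_summable_on) (rule finite_subset[OF _ assms], auto)

lemma square_summable_unit [simp]: "(\<lambda>i. if i = k then 1 else 0) \<in> square_summable"
  using square_summable_finite_support[of "{k}" "\<lambda>_. 1"] by simp

lemma summable_on_mult_cnj:
  assumes "x \<in> square_summable" "y \<in> square_summable"
  shows "(\<lambda>i. x i * cnj (y i)) summable_on UNIV"
  by (rule abs_summable_summable, rule abs_summable_product)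
    (use assms in \<open>auto simp: square_summable_def norm_mult power2_eq_square\<close>)

lemma cinner_ell2_self:
  "cinner ell2 x x = complex_of_real (\<Sum>\<^sub>\<infinity>i. (cmod (x i))\<^sup>2)"
proof -
  have "cinner ell2 x x = (\<Sum>\<^sub>\<infinity>i. complex_of_real ((cmod (x i))\<^sup>2))"
    unfolding cinner_ell2 by (simp only: complex_norm_square)
  also have "\<dots> = complex_of_real (\<Sum>\<^sub>\<infinity>i. (cmod (x i))\<^sup>2)"
  proof (cases "(\<lambda>i. (cmod (x i))\<^sup>2) summable_on UNIV")
    case True
    then show ?thesis
      by (intro infsumI has_sum_of_real has_sum_infsum)
  next
    case False
    then have "\<not> (\<lambda>i. complex_of_real ((cmod (x i))\<^sup>2)) summable_on UNIV"
      using summable_on_Re by fastforce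
    with False show ?thesis
      by (simp add: infsum_not_exists)
  qed
  finally show ?thesis .
qed

lemma cnorm_ell2: "cnorm ell2 x = sqrt (\<Sum>\<^sub>\<infinity>i. (cmod (x i))\<^sup>2)"
  by (simp add: cnorm_def cinner_ell2_self)

lemma cinner_ell2_unit [simp]:
  "cinner ell2 (\<lambda>i. if i = k then 1 else 0) y = cnj (y k)"
  "cinner ell2 y (\<lambda>i. if i = k then 1 else 0) = y k"
proof -
  have "cinner ell2 (\<lambda>i. if i = k then 1 else 0) y
      = (\<Sum>\<^sub>\<infinity>i\<in>{k}. (if i = k then 1 else 0) * cnj (y i))"
    unfolding cinner_ell2 by (rule infsum_cong_neutral) auto
  then show "cinner ell2 (\<lambda>i. if i = k then 1 else 0) y = cnj (y k)" by simp
  have "cinner ell2 y (\<lambda>i. if i = k then 1 else 0)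
      = (\<Sum>\<^sub>\<infinity>i\<in>{k}. y i * cnj (if i = k then 1 else 0))"
    unfolding cinner_ell2 by (rule infsum_cong_neutral) auto
  then show "cinner ell2 y (\<lambda>i. if i = k then 1 else 0) = y k" by simp
qed

lemma cring_complex_ring: "cring complex_ring"
proof (rule cringI)
  show "abelian_group complex_ring"
    by (rule abelian_groupI) (auto simp: complex_ring_def intro: exI[of _ "- x" for x])
  show "comm_monoid complex_ring"
    by (rule comm_monoidI) (auto simp: complex_ring_def)
qed (auto simp: complex_ring_def algebra_simps)

lemma module_ell2: "Module.module complex_ring ell2"
proof (rule moduleI[OF cring_complex_ring])
  show "abelian_group (ell2 :: ('i \<Rightarrow> complex) cinner_space)"
  proof (rule abelian_groupI)
    fix x :: "'i \<Rightarrow> complex" assume "x \<in> carrier ell2"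
    then show "\<exists>y\<in>carrier ell2. y \<oplus>\<^bsub>ell2\<^esub> x = \<zero>\<^bsub>ell2\<^esub>"
      by (intro bexI[of _ "\<lambda>i. - x i"]) auto
  qed (auto simp: algebra_simps)
qed (auto simp: complex_ring_def algebra_simps)

interpretation ell2: complex_inner_product_space ell2
proof (rule complex_inner_product_space.intro[OF module_ell2], unfold_locales, unfold ell2_simps)
  fix x y z :: "'i \<Rightarrow> complex" and c
  show "cinner ell2 (\<lambda>i. x i + y i) z = cinner ell2 x z + cinner ell2 y z"
    if "x \<in> square_summable" "y \<in> square_summable" "z \<in> square_summable"
    using that by (simp add: cinner_ell2 distrib_right infsum_add summable_on_mult_cnj)
  show "cinner ell2 (\<lambda>i. c * x i) y = c * cinner ell2 x y"
    by (simp add: cinner_ell2 mult.assoc infsum_cmult_right')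
  show "cinner ell2 y x = cnj (cinner ell2 x y)"
    by (simp add: cinner_ell2 mult.commute flip: infsum_cnj)
  show "0 < Re (cinner ell2 x x)" if x: "x \<in> square_summable" "x \<noteq> (\<lambda>i. 0)"
  proof -
    from x obtain k where "x k \<noteq> 0" by auto
    then have "0 < (\<Sum>i\<in>{k}. (cmod (x i))\<^sup>2)" by simp
    also have "\<dots> \<le> (\<Sum>\<^sub>\<infinity>i. (cmod (x i))\<^sup>2)"
      by (rule finite_sum_le_infsum) (use x in \<open>auto simp: square_summable_def\<close>)
    finally show ?thesis by (simp add: cinner_ell2_self)
  qed
qed

lemma ell2_uminus: "y \<in> square_summable \<Longrightarrow> \<ominus>\<^bsub>ell2\<^esub> y = (\<lambda>i. - y i)"
  by (rule ell2.M.minus_equality) auto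

lemma ell2_minus:
  "y \<in> square_summable \<Longrightarrow> x \<ominus>\<^bsub>ell2\<^esub> y = (\<lambda>i. x i - y i)"
  by (simp add: a_minus_def ell2_uminus)

lemma cdist_ell2:
  assumes "x \<in> square_summable" "y \<in> square_summable"
  shows "cdist ell2 x y = sqrt (\<Sum>\<^sub>\<infinity>i. (cmod (x i - y i))\<^sup>2)"
  using assms by (simp add: cdist_def ell2_minus cnorm_ell2)

lemma finite_sum_le_cdist_ell2:
  assumes "x \<in> square_summable" "y \<in> square_summable" "finite F"
  shows "(\<Sum>i\<in>F. (cmod (x i - y i))\<^sup>2) \<le> (cdist ell2 x y)\<^sup>2"
proof -
  have "(\<Sum>i\<in>F. (cmod (x i - y i))\<^sup>2) \<le> (\<Sum>\<^sub>\<infinity>i. (cmod (x i - y i))\<^sup>2)"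
    by (rule finite_sum_le_infsum)
      (use square_summable_diff[OF assms(1,2)] assms(3) in \<open>auto simp: square_summable_def\<close>)
  then show ?thesis
    using assms by (simp add: cdist_ell2 infsum_nonneg)
qed

text \<open>A Cauchy sequence converges coordinatewise; the estimates over finite index sets survive that
  limit and then bound the whole sum.\<close>

lemma complex_hilbert_space_ell2: "complex_hilbert_space ell2"
proof (rule complex_hilbert_space.intro[OF ell2.complex_inner_product_space_axioms], unfold_locales)
  show "ell2.mcomplete TYPE('i)"
    unfolding ell2.mcomplete_def
  proof (intro allI impI)
    fix s :: "nat \<Rightarrow> 'i \<Rightarrow> complex"
    assume "ell2.MCauchy s"
    then have s: "s n \<in> square_summable" 
      and C: "\<And>e. e > 0 \<Longrightarrow> \<exists>N. \<forall>n m. N \<le> n \<longrightarrow> N \<le> m \<longrightarrow> cdist ell2 (s n) (s m) < e" for n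
      unfolding ell2.MCauchy_def by auto
    have coord: "cmod (s n i - s m i) \<le> cdist ell2 (s n) (s m)" for n m i
      using finite_sum_le_cdist_ell2[OF s[of n] s[of m], of "{i}"]
      by (simp add: power2_le_iff_abs_le)
    have "Cauchy (\<lambda>n. s n i)" for i
    proof (rule metric_CauchyI)
      fix e :: real assume "e > 0"
      with C[of e] show "\<exists>N. \<forall>m\<ge>N. \<forall>n\<ge>N. dist (s m i) (s n i) < e"
        unfolding dist_norm by (meson coord order_le_less_trans)
    qed
    then obtain x where x: "\<And>i. (\<lambda>n. s n i) \<longlonglongrightarrow> x i"
      unfolding Cauchy_convergent_iff convergent_def by metis
    have tail: "\<exists>N. \<forall>n\<ge>N. \<forall>F. finite F \<longrightarrow> (\<Sum>i\<in>F. (cmod (s n i - x i))\<^sup>2) \<le> e\<^sup>2"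
      if "e > 0" for e
    proof -
      from C[OF that] obtain N
        where N: "\<And>n m. N \<le> n \<Longrightarrow> N \<le> m \<Longrightarrow> cdist ell2 (s n) (s m) < e" by blast
      have "(\<Sum>i\<in>F. (cmod (s n i - x i))\<^sup>2) \<le> e\<^sup>2" if "n \<ge> N" "finite F" for n F
      proof (rule LIMSEQ_le_const2)
        show "(\<lambda>m. \<Sum>i\<in>F. (cmod (s n i - s m i))\<^sup>2) \<longlonglongrightarrow> (\<Sum>i\<in>F. (cmod (s n i - x i))\<^sup>2)"
          by (intro tendsto_intros x)
        have "(\<Sum>i\<in>F. (cmod (s n i - s m i))\<^sup>2) \<le> e\<^sup>2" if "m \<ge> N" for m
        proof -
          have "(\<Sum>i\<in>F. (cmod (s n i - s m i))\<^sup>2) \<le> (cdist ell2 (s n) (s m))\<^sup>2"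
            by (rule finite_sum_le_cdist_ell2[OF s s \<open>finite F\<close>])
          also have "\<dots> \<le> e\<^sup>2"
            using N[OF \<open>n \<ge> N\<close> that] by (intro power_mono) auto
          finally show ?thesis .
        qed
        then show "\<exists>M. \<forall>m\<ge>M. (\<Sum>i\<in>F. (cmod (s n i - s m i))\<^sup>2) \<le> e\<^sup>2" by blast
      qed
      then show ?thesis by blast
    qed
    have "x \<in> square_summable"
    proof -
      from tail[of 1] obtain N
        where N: "\<And>F. finite F \<Longrightarrow> (\<Sum>i\<in>F. (cmod (s N i - x i))\<^sup>2) \<le> 1" by auto
      have "(\<lambda>i. (cmod (s N i - x i))\<^sup>2) summable_on UNIV"
        by (rule nonneg_bdd_above_summable_on) (auto intro!: bdd_aboveI2[where M = 1] N)
      then have "(\<lambda>i. s N i - x i) \<in> square_summable"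
        by (simp add: square_summable_def)
      from square_summable_diff[OF s[of N] this] show ?thesis by simp
    qed
    moreover have "\<exists>N. \<forall>n\<ge>N. cdist ell2 (s n) x < e" if "e > 0" for e
    proof -
      from tail[of "e / 2"] that obtain N where
        N: "\<And>n F. n \<ge> N \<Longrightarrow> finite F \<Longrightarrow> (\<Sum>i\<in>F. (cmod (s n i - x i))\<^sup>2) \<le> (e / 2)\<^sup>2" by auto
      have "cdist ell2 (s n) x < e" if "n \<ge> N" for n
      proof -
        have "(\<lambda>i. s n i - x i) \<in> square_summable"
          using s \<open>x \<in> square_summable\<close> by simp
        then have "(\<Sum>\<^sub>\<infinity>i. (cmod (s n i - x i))\<^sup>2) \<le> (e / 2)\<^sup>2"
          by (intro infsum_le_finite_sums N that) (auto simp: square_summable_def)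
        then have "cdist ell2 (s n) x \<le> e / 2"
          unfolding cdist_ell2[OF s \<open>x \<in> square_summable\<close>]
          using \<open>e > 0\<close> by (intro real_le_lsqrt) auto
        then show ?thesis using \<open>e > 0\<close> by simp
      qed
      then show ?thesis by blast
    qed
    ultimately show "\<exists>x. limitin ell2.mtopology s x sequentially"
      unfolding ell2.limit_metric_sequentially using s by auto
  qed
qed

section \<open>Linear operators and their adjoints\<close>

lemma linear_operator_ell2I:
  assumes "opdom T \<subseteq> square_summable" "(\<lambda>i. 0) \<in> opdom T"
    and "\<And>x y. x \<in> opdom T \<Longrightarrow> y \<in> opdom T \<Longrightarrow> (\<lambda>i. x i + y i) \<in> opdom T"
    and "\<And>c x. x \<in> opdom T \<Longrightarrow> (\<lambda>i. c * x i) \<in> opdom T"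
    and "\<And>x. x \<in> opdom T \<Longrightarrow> opfun T x \<in> square_summable"
    and "\<And>x y. x \<in> opdom T \<Longrightarrow> y \<in> opdom T \<Longrightarrow>
           opfun T (\<lambda>i. x i + y i) = (\<lambda>i. opfun T x i + opfun T y i)"
    and "\<And>c x. x \<in> opdom T \<Longrightarrow> opfun T (\<lambda>i. c * x i) = (\<lambda>i. c * opfun T x i)"
  shows "linear_operator ell2 T"
proof -
  have "submodule (opdom T) complex_ring ell2"
  proof (rule ell2.submoduleI)
    fix x assume x: "x \<in> opdom T"
    then have "\<ominus>\<^bsub>ell2\<^esub> x = (\<lambda>i. - 1 * x i)"
      using assms(1) by (subst ell2_uminus) auto
    then show "\<ominus>\<^bsub>ell2\<^esub> x \<in> opdom T"
      using assms(4)[OF x, of "- 1"] by simp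
  qed (use assms in auto)
  with assms show ?thesis
    by (simp add: linear_operator_def)
qed

text \<open>The unit vectors separate points, so a vector representing the functional
  \<open>x \<mapsto> \<langle>T x, y\<rangle>\<close> is unique as soon as the domain of \<open>T\<close> contains them.\<close>

lemma op_adjoint_ell2_apply:
  assumes units: "\<And>k. (\<lambda>i. if i = k then 1 else 0) \<in> opdom T"
    and z: "z \<in> square_summable" "\<And>x. x \<in> opdom T \<Longrightarrow> cinner ell2 (opfun T x) y = cinner ell2 x z"
  shows "opfun (op_adjoint ell2 T) y = z"
proof -
  have "z' = z" if "\<forall>x\<in>opdom T. cinner ell2 (opfun T x) y = cinner ell2 x z'" for z'
  proof
    fix k
    have "cinner ell2 (\<lambda>i. if i = k then 1 else 0) z' = cinner ell2 (\<lambda>i. if i = k then 1 else 0) z"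
      using that z(2) units[of k] by metis
    then show "z' k = z k" by simp
  qed
  with z show ?thesis
    by (auto simp: op_adjoint_def intro!: the_equality)
qed

section \<open>Multiplication operators\<close>

definition multiplication_operator :: "('i \<Rightarrow> real) \<Rightarrow> ('i \<Rightarrow> complex) operator" where
  "multiplication_operator t =
     \<lparr>opdom = {x \<in> square_summable. (\<lambda>i. complex_of_real (t i) * x i) \<in> square_summable},
      opfun = (\<lambda>x i. complex_of_real (t i) * x i)\<rparr>"

lemma finite_support_in_multiplication_domain:
  assumes "finite F"
  shows "(\<lambda>i. if i \<in> F then x i else 0) \<in> opdom (multiplication_operator t)"
  using square_summable_finite_support[OF assms, of x]
    square_summable_finite_support[OF assms, of "\<lambda>i. complex_of_real (t i) * x i"]
  by (simp add: multiplication_operator_def if_distrib cong: if_cong)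

lemma unit_in_multiplication_domain:
  "(\<lambda>i. if i = k then 1 else 0) \<in> opdom (multiplication_operator t)"
  using finite_support_in_multiplication_domain[of "{k}" "\<lambda>_. 1" t] by simp

lemma linear_multiplication_operator: "linear_operator ell2 (multiplication_operator t)"
proof (rule linear_operator_ell2I)
  fix x y assume "x \<in> opdom (multiplication_operator t)" "y \<in> opdom (multiplication_operator t)"
  then show "(\<lambda>i. x i + y i) \<in> opdom (multiplication_operator t)"
    by (simp add: multiplication_operator_def distrib_left)
next
  fix c x assume "x \<in> opdom (multiplication_operator t)"
  then show "(\<lambda>i. c * x i) \<in> opdom (multiplication_operator t)"
    using square_summable_scale[of "\<lambda>i. complex_of_real (t i) * x i" c]
    by (simp add: multiplication_operator_def mult.left_commute)
qed (auto simp: multiplication_operator_def algebra_simps)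

text \<open>Truncations to finite index sets lie in the domain and approximate every vector.\<close>

lemma densely_defined_multiplication_operator:
  fixes t :: "'i \<Rightarrow> real"
  shows "densely_defined ell2 (multiplication_operator t)"
  unfolding densely_defined_def ell2.metric_closure_of
proof (intro equalityI subsetI CollectI conjI allI impI)
  fix x :: "'i \<Rightarrow> complex" and r :: real
  assume "x \<in> carrier ell2" and r: "0 < r"
  then have x: "x \<in> square_summable" by simp
  define f where "f = (\<lambda>i. (cmod (x i))\<^sup>2)"
  have f: "f summable_on UNIV"
    using x by (simp add: square_summable_def f_def)
  obtain F where F: "finite F" "dist (sum f F) (infsum f UNIV) \<le> r\<^sup>2 / 2"
    using infsum_finite_approximation[OF f, of "r\<^sup>2 / 2"] r by auto
  define y where "y = (\<lambda>i. if i \<in> F then x i else 0)"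
  have y: "y \<in> opdom (multiplication_operator t)"
    unfolding y_def by (rule finite_support_in_multiplication_domain[OF F(1)])
  then have ys: "y \<in> square_summable" by (simp add: multiplication_operator_def)
  have "(\<Sum>\<^sub>\<infinity>i. (cmod (x i - y i))\<^sup>2) = infsum f (UNIV - F)"
    by (rule infsum_cong_neutral) (auto simp: y_def f_def)
  also have "\<dots> = infsum f UNIV - sum f F"
    using infsum_Diff[OF f summable_on_finite[OF F(1)]] F(1) by simp
  also have "\<dots> < r\<^sup>2"
    using F(2) r by (simp add: dist_real_def abs_le_iff) (smt (verit) zero_less_power field_sum_of_halves)
  finally have "cdist ell2 x y < r"
    using r unfolding cdist_ell2[OF x ys] by (intro real_less_lsqrt) (auto simp: infsum_nonneg)
  then show "\<exists>y\<in>opdom (multiplication_operator t). y \<in> ell2.mball x r"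
    using x ys y unfolding ell2.in_mball by auto
qed auto

text \<open>Testing against unit vectors shows that \<open>z\<close> represents \<open>x \<mapsto> \<langle>T x, y\<rangle>\<close> only if
  \<open>z = t y\<close>, and then \<open>y\<close> already lies in the maximal domain.\<close>

lemma self_adjoint_multiplication_operator: "self_adjoint ell2 (multiplication_operator t)"
proof -
  let ?T = "multiplication_operator t" and ?e = "\<lambda>k i. if i = k then 1 else 0 :: complex"
  have sym: "cinner ell2 (opfun ?T x) y = cinner ell2 x (\<lambda>i. complex_of_real (t i) * y i)" for x y
    by (simp add: multiplication_operator_def cinner_ell2 mult_ac)
  have "y \<in> opdom ?T \<and> opfun ?T y = opfun (op_adjoint ell2 ?T) y"
    if y: "y \<in> opdom (op_adjoint ell2 ?T)" for y
  proof -
    obtain z where z: "z \<in> square_summable"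
        "\<And>x. x \<in> opdom ?T \<Longrightarrow> cinner ell2 (opfun ?T x) y = cinner ell2 x z"
      and ys: "y \<in> square_summable"
      using y by (auto simp: op_adjoint_def)
    have "z = (\<lambda>i. complex_of_real (t i) * y i)"
    proof
      fix k
      have "cinner ell2 (?e k) z = cinner ell2 (?e k) (\<lambda>i. complex_of_real (t i) * y i)"
        using z(2)[OF unit_in_multiplication_domain] by (simp only: sym)
      then show "z k = complex_of_real (t k) * y k" by (simp flip: complex_cnj_mult)
    qed
    then show ?thesis
      using op_adjoint_ell2_apply[OF unit_in_multiplication_domain z] z(1) ys
      by (simp add: multiplication_operator_def)
  qed
  moreover have "y \<in> opdom (op_adjoint ell2 ?T)" if y: "y \<in> opdom ?T" for y
    using y sym by (auto simp: op_adjoint_def multiplication_operator_def)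
  ultimately show ?thesis
    unfolding self_adjoint_def op_eq_def op_le_def
    using linear_multiplication_operator densely_defined_multiplication_operator by fastforce
qed

section \<open>Operators with a kernel of bounded row and column sums\<close>

definition kernel_operator :: "('i \<Rightarrow> 'i \<Rightarrow> complex) \<Rightarrow> ('i \<Rightarrow> complex) operator" where
  "kernel_operator k =
     \<lparr>opdom = square_summable, opfun = (\<lambda>x m. \<Sum>\<^sub>\<infinity>n. k m n * x n)\<rparr>"

definition adjoint_kernel :: "('i \<Rightarrow> 'i \<Rightarrow> complex) \<Rightarrow> 'i \<Rightarrow> 'i \<Rightarrow> complex" where
  "adjoint_kernel k m n = cnj (k n m)"

lemma adjoint_kernel_involution [simp]: "adjoint_kernel (adjoint_kernel k) = k"
  by (simp add: adjoint_kernel_def fun_eq_iff)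

lemma opdom_kernel_operator [simp]: "opdom (kernel_operator k) = square_summable"
  by (simp add: kernel_operator_def)

lemma kernel_operator_unit:
  "opfun (kernel_operator k) (\<lambda>i. if i = l then 1 else 0) = (\<lambda>m. k m l)"
proof
  fix m
  have "(\<Sum>\<^sub>\<infinity>n. k m n * (if n = l then 1 else 0)) = (\<Sum>\<^sub>\<infinity>n\<in>{l}. k m n * (if n = l then 1 else 0))"
    by (rule infsum_cong_neutral) auto
  then show "opfun (kernel_operator k) (\<lambda>i. if i = l then 1 else 0) m = k m l"
    by (simp add: kernel_operator_def)
qed

locale schur_kernel =
  fixes k :: "'i \<Rightarrow> 'i \<Rightarrow> complex" and M :: real
  assumes M_pos: "0 < M"
    and row_summable: "(\<lambda>n. cmod (k m n)) summable_on UNIV"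
    and row_sum_le: "(\<Sum>\<^sub>\<infinity>n. cmod (k m n)) \<le> M"
    and column_summable: "(\<lambda>m. cmod (k m n)) summable_on UNIV"
    and column_sum_le: "(\<Sum>\<^sub>\<infinity>m. cmod (k m n)) \<le> M"
begin

lemma schur_kernel_adjoint: "schur_kernel (adjoint_kernel k) M"
  using M_pos row_summable row_sum_le column_summable column_sum_le
  by unfold_locales (simp_all add: adjoint_kernel_def)

text \<open>By Tonelli the double sum may be taken over \<open>m\<close> first, where the column sums bound it.\<close>

lemma column_weighted:
  assumes v: "v summable_on UNIV" "\<And>n. 0 \<le> v n"
  shows column_weighted_summable: "(\<lambda>(m, n). cmod (k m n) * v n) summable_on UNIV \<times> UNIV"
    and column_weighted_le: "(\<Sum>\<^sub>\<infinity>m. \<Sum>\<^sub>\<infinity>n. cmod (k m n) * v n) \<le> M * (\<Sum>\<^sub>\<infinity>n. v n)"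
proof -
  let ?c = "\<lambda>n. \<Sum>\<^sub>\<infinity>m. cmod (k m n)"
  have c: "0 \<le> ?c n * v n \<and> ?c n * v n \<le> M * v n" for n
    using v(2)[of n] column_sum_le[of n] by (simp add: mult_right_mono infsum_nonneg)
  have Mv: "(\<lambda>n. M * v n) summable_on UNIV"
    using v(1) by (rule summable_on_cmult_right)
  have cv: "(\<lambda>n. ?c n * v n) summable_on UNIV"
    by (rule summable_on_comparison_test[OF Mv]) (use c in auto)
  have "(\<lambda>(n, m). cmod (k m n) * v n) summable_on UNIV \<times> UNIV"
  proof (rule summable_on_SigmaI[OF _ cv])
    show "((\<lambda>m. case (n, m) of (n, m) \<Rightarrow> cmod (k m n) * v n) has_sum ?c n * v n) UNIV" for n
      unfolding prod.case by (intro has_sum_cmult_left has_sum_infsum column_summable)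
  qed (use v in auto)
  then show S: "(\<lambda>(m, n). cmod (k m n) * v n) summable_on UNIV \<times> UNIV"
    by (subst summable_on_swap) (simp add: case_prod_unfold)
  have "(\<Sum>\<^sub>\<infinity>m. \<Sum>\<^sub>\<infinity>n. cmod (k m n) * v n) = (\<Sum>\<^sub>\<infinity>n. ?c n * v n)"
    by (simp add: infsum_swap_banach[OF S] infsum_cmult_left')
  also have "\<dots> \<le> (\<Sum>\<^sub>\<infinity>n. M * v n)"
    by (rule infsum_mono[OF cv Mv]) (use c in auto)
  finally show "(\<Sum>\<^sub>\<infinity>m. \<Sum>\<^sub>\<infinity>n. cmod (k m n) * v n) \<le> M * (\<Sum>\<^sub>\<infinity>n. v n)"
    by (simp add: infsum_cmult_right')
qed

lemma row_weighted_summable: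
  assumes "v summable_on UNIV" "\<And>m. 0 \<le> v m"
  shows "(\<lambda>(m, n). cmod (k m n) * v m) summable_on UNIV \<times> UNIV"
  using schur_kernel.column_weighted_summable[OF schur_kernel_adjoint assms]
  by (subst summable_on_swap) (simp add: adjoint_kernel_def case_prod_unfold)

text \<open>Absolute convergence comes from \<open>|x\<^sub>n y\<^sub>m| \<le> |x\<^sub>n|\<^sup>2 + |y\<^sub>m|\<^sup>2\<close>, which splits the double series into one
  governed by the column sums and one governed by the row sums.\<close>

lemma sesquilinear_form_summable:
  assumes x: "x \<in> square_summable" and y: "y \<in> square_summable"
  shows "(\<lambda>(m, n). k m n * x n * cnj (y m)) summable_on UNIV \<times> UNIV"
proof -
  have "(\<lambda>p. (case p of (m, n) \<Rightarrow> cmod (k m n) * (cmod (x n))\<^sup>2)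
           + (case p of (m, n) \<Rightarrow> cmod (k m n) * (cmod (y m))\<^sup>2)) summable_on UNIV \<times> UNIV"
    using x y by (intro summable_on_add column_weighted_summable row_weighted_summable)
      (auto simp: square_summable_def)
  then have "(\<lambda>p. norm (case p of (m, n) \<Rightarrow> k m n * x n * cnj (y m))) summable_on UNIV \<times> UNIV"
  proof (rule summable_on_comparison_test)
    fix p :: "'i \<times> 'i"
    obtain m n where p: "p = (m, n)" by (cases p)
    have "cmod (x n) * cmod (y m) \<le> (cmod (x n))\<^sup>2 + (cmod (y m))\<^sup>2"
      using sum_squares_bound[of "cmod (x n)" "cmod (y m)"]
        mult_nonneg_nonneg[OF norm_ge_zero norm_ge_zero, of "x n" "y m"] by linarith
    then have "cmod (k m n) * (cmod (x n) * cmod (y m))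
        \<le> cmod (k m n) * ((cmod (x n))\<^sup>2 + (cmod (y m))\<^sup>2)"
      by (intro mult_left_mono) auto
    then show "norm (case p of (m, n) \<Rightarrow> k m n * x n * cnj (y m))
        \<le> (case p of (m, n) \<Rightarrow> cmod (k m n) * (cmod (x n))\<^sup>2)
           + (case p of (m, n) \<Rightarrow> cmod (k m n) * (cmod (y m))\<^sup>2)"
      by (simp add: p norm_mult distrib_left mult.assoc)
  qed simp
  then show ?thesis by (rule abs_summable_summable)
qed

lemma row_product_summable:
  assumes "x \<in> square_summable"
  shows "(\<lambda>n. k m n * x n) summable_on UNIV"
  using summable_on_SigmaD1[OF sesquilinear_form_summable[OF assms square_summable_unit[of m]], of m]
  by simp

text \<open>The Schur test. Summing \<open>2 s |x\<^sub>n| \<le> s\<^sup>2 + |x\<^sub>n|\<^sup>2\<close> against the weights \<open>|k m n|\<close> gives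
  \<open>2 s r \<le> M s\<^sup>2 + Q\<close> for every \<open>s \<ge> 0\<close>, where \<open>r\<close> is the modulus of the \<open>m\<close>-th coordinate and \<open>Q\<close> the sum of
  all \<open>|k m n| |x\<^sub>n|\<^sup>2\<close>; the best choice \<open>s = r / M\<close> yields \<open>r\<^sup>2 \<le> M Q\<close>.\<close>

lemma coordinate_bound:
  assumes x: "x \<in> square_summable"
  shows "(cmod (opfun (kernel_operator k) x m))\<^sup>2 \<le> M * (\<Sum>\<^sub>\<infinity>n. cmod (k m n) * (cmod (x n))\<^sup>2)"
proof -
  define r where "r = cmod (opfun (kernel_operator k) x m)"
  define s where "s = r / M"
  let ?R = "\<Sum>\<^sub>\<infinity>n. cmod (k m n) * cmod (x n)" and ?Q = "\<Sum>\<^sub>\<infinity>n. cmod (k m n) * (cmod (x n))\<^sup>2"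
  have sR: "(\<lambda>n. cmod (k m n) * cmod (x n)) summable_on UNIV"
    using row_product_summable[OF x, of m]
    by (simp add: summable_on_iff_abs_summable_on_complex norm_mult)
  have sQ: "(\<lambda>n. cmod (k m n) * (cmod (x n))\<^sup>2) summable_on UNIV"
    using summable_on_SigmaD1[OF column_weighted_summable, of "\<lambda>n. (cmod (x n))\<^sup>2" m] x
    by (simp add: square_summable_def)
  have s: "0 \<le> s" using M_pos by (simp add: s_def r_def)
  have "r \<le> ?R"
    unfolding r_def kernel_operator_def
    using norm_infsum_bound[of "\<lambda>n. k m n * x n" UNIV] sR by (simp add: norm_mult)
  then have "2 * s * r \<le> 2 * s * ?R"
    using s by (intro mult_left_mono) auto
  also have "\<dots> = (\<Sum>\<^sub>\<infinity>n. 2 * s * (cmod (k m n) * cmod (x n)))"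
    by (simp add: infsum_cmult_right')
  also have "\<dots> \<le> (\<Sum>\<^sub>\<infinity>n. s\<^sup>2 * cmod (k m n) + cmod (k m n) * (cmod (x n))\<^sup>2)"
  proof (rule infsum_mono)
    show "(\<lambda>n. 2 * s * (cmod (k m n) * cmod (x n))) summable_on UNIV"
      by (intro summable_on_cmult_right sR)
    show "(\<lambda>n. s\<^sup>2 * cmod (k m n) + cmod (k m n) * (cmod (x n))\<^sup>2) summable_on UNIV"
      by (intro summable_on_add summable_on_cmult_right row_summable sQ)
    show "2 * s * (cmod (k m n) * cmod (x n)) \<le> s\<^sup>2 * cmod (k m n) + cmod (k m n) * (cmod (x n))\<^sup>2" for n
      using mult_left_mono[OF sum_squares_bound[of s "cmod (x n)"], of "cmod (k m n)"]
      by (simp add: algebra_simps)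
  qed
  also have "\<dots> = s\<^sup>2 * (\<Sum>\<^sub>\<infinity>n. cmod (k m n)) + ?Q"
    by (subst infsum_add) (auto simp: infsum_cmult_right' intro: summable_on_cmult_right row_summable sQ)
  also have "\<dots> \<le> s\<^sup>2 * M + ?Q"
    using row_sum_le[of m] by (intro add_right_mono mult_left_mono) auto
  finally have "r\<^sup>2 / M \<le> ?Q"
    using M_pos by (simp add: s_def power2_eq_square)
  then show ?thesis
    using M_pos by (simp add: r_def field_simps)
qed

lemma kernel_operator_bounded:
  assumes x: "x \<in> square_summable"
  shows kernel_operator_square_summable: "opfun (kernel_operator k) x \<in> square_summable"
    and cnorm_kernel_operator_le: "cnorm ell2 (opfun (kernel_operator k) x) \<le> M * cnorm ell2 x"
proof -
  let ?y = "opfun (kernel_operator k) x"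
  let ?Q = "\<lambda>m. \<Sum>\<^sub>\<infinity>n. cmod (k m n) * (cmod (x n))\<^sup>2"
  have x2: "(\<lambda>n. (cmod (x n))\<^sup>2) summable_on UNIV"
    using x by (simp add: square_summable_def)
  have "?Q summable_on UNIV"
    by (rule summable_on_Sigma_banach) (rule column_weighted_summable[OF x2], simp)
  then have MQ: "(\<lambda>m. M * ?Q m) summable_on UNIV"
    by (rule summable_on_cmult_right)
  then have y2: "(\<lambda>m. (cmod (?y m))\<^sup>2) summable_on UNIV"
    by (rule summable_on_comparison_test) (use coordinate_bound[OF x] in auto)
  then show "?y \<in> square_summable" by (simp add: square_summable_def)
  have "(\<Sum>\<^sub>\<infinity>m. (cmod (?y m))\<^sup>2) \<le> (\<Sum>\<^sub>\<infinity>m. M * ?Q m)"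
    by (rule infsum_mono[OF y2 MQ coordinate_bound[OF x]])
  also have "\<dots> = M * (\<Sum>\<^sub>\<infinity>m. ?Q m)"
    by (simp add: infsum_cmult_right')
  also have "\<dots> \<le> M * (M * (\<Sum>\<^sub>\<infinity>n. (cmod (x n))\<^sup>2))"
    using M_pos column_weighted_le[OF x2] by (intro mult_left_mono) auto
  also have "\<dots> = M\<^sup>2 * (\<Sum>\<^sub>\<infinity>n. (cmod (x n))\<^sup>2)"
    by (simp add: power2_eq_square)
  finally show "cnorm ell2 ?y \<le> M * cnorm ell2 x"
    unfolding cnorm_ell2 using M_pos real_sqrt_le_mono by (fastforce simp: real_sqrt_mult)
qed

lemma kernel_operator_in_bounded_operators: "kernel_operator k \<in> bounded_operators ell2"
proof -
  have "linear_operator ell2 (kernel_operator k)"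
  proof (rule linear_operator_ell2I)
    fix x y assume "x \<in> opdom (kernel_operator k)" "y \<in> opdom (kernel_operator k)"
    then show "opfun (kernel_operator k) (\<lambda>i. x i + y i)
        = (\<lambda>i. opfun (kernel_operator k) x i + opfun (kernel_operator k) y i)"
      by (simp add: kernel_operator_def distrib_left infsum_add row_product_summable)
  next
    fix c x
    show "opfun (kernel_operator k) (\<lambda>i. c * x i) = (\<lambda>i. c * opfun (kernel_operator k) x i)"
      by (simp add: kernel_operator_def mult.left_commute[of _ c] infsum_cmult_right')
  qed (auto simp: kernel_operator_square_summable)
  then show ?thesis
    by (auto simp: bounded_operators_def intro: cnorm_kernel_operator_le)
qed

lemma cinner_kernel_operator:
  assumes x: "x \<in> square_summable" and y: "y \<in> square_summable"
  shows "cinner ell2 (opfun (kernel_operator k) x) y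
    = cinner ell2 x (opfun (kernel_operator (adjoint_kernel k)) y)"
proof -
  have "cinner ell2 (opfun (kernel_operator k) x) y = (\<Sum>\<^sub>\<infinity>m. \<Sum>\<^sub>\<infinity>n. k m n * x n * cnj (y m))"
    by (simp add: cinner_ell2 kernel_operator_def infsum_cmult_left')
  also have "\<dots> = (\<Sum>\<^sub>\<infinity>n. \<Sum>\<^sub>\<infinity>m. k m n * x n * cnj (y m))"
    by (rule infsum_swap_banach[OF sesquilinear_form_summable[OF x y]])
  also have "\<dots> = (\<Sum>\<^sub>\<infinity>n. x n * (\<Sum>\<^sub>\<infinity>m. k m n * cnj (y m)))"
    by (simp add: mult_ac flip: infsum_cmult_right')
  also have "\<dots> = cinner ell2 x (opfun (kernel_operator (adjoint_kernel k)) y)"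
    by (simp add: cinner_ell2 kernel_operator_def adjoint_kernel_def flip: infsum_cnj)
  finally show ?thesis .
qed

lemma op_adjoint_kernel_operator:
  shows opdom_adjoint_kernel_operator:
      "opdom (op_adjoint ell2 (kernel_operator k)) = square_summable"
    and opfun_adjoint_kernel_operator:
      "\<And>y. y \<in> square_summable \<Longrightarrow>
        opfun (op_adjoint ell2 (kernel_operator k)) y = opfun (kernel_operator (adjoint_kernel k)) y"
proof -
  have sq: "opfun (kernel_operator (adjoint_kernel k)) y \<in> square_summable"
    if "y \<in> square_summable" for y
    using schur_kernel.kernel_operator_square_summable[OF schur_kernel_adjoint that] .
  then show "opdom (op_adjoint ell2 (kernel_operator k)) = square_summable"
    by (auto simp: op_adjoint_def intro!: bexI[OF _ sq] cinner_kernel_operator)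
  show "opfun (op_adjoint ell2 (kernel_operator k)) y = opfun (kernel_operator (adjoint_kernel k)) y"
    if "y \<in> square_summable" for y
    by (rule op_adjoint_ell2_apply) (use that sq cinner_kernel_operator in auto)
qed

text \<open>Moving both factors across the inner product reduces \<open>K\<^sup>* K x = x\<close> to the case of unit vectors, which
  is the orthonormality of the columns.\<close>

lemma adjoint_kernel_operator_left_inverse:
  assumes orthonormal: "\<And>l n. (\<Sum>\<^sub>\<infinity>m. cnj (k m l) * k m n) = (if l = n then 1 else 0)"
    and x: "x \<in> square_summable"
  shows "opfun (kernel_operator (adjoint_kernel k)) (opfun (kernel_operator k) x) = x"
proof
  fix l
  let ?e = "\<lambda>i :: 'i. if i = l then 1 else 0 :: complex"
  interpret adj: schur_kernel "adjoint_kernel k" M by (rule schur_kernel_adjoint)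
  let ?K = "opfun (kernel_operator k)" and ?A = "opfun (kernel_operator (adjoint_kernel k))"
  have AKe: "?A (?K ?e) = ?e"
    unfolding kernel_operator_unit using orthonormal
    by (auto simp: kernel_operator_def adjoint_kernel_def)
  have "?A (?K x) l = cinner ell2 (?A (?K x)) ?e" by simp
  also have "\<dots> = cinner ell2 (?K x) (?K ?e)"
    using adj.cinner_kernel_operator[OF kernel_operator_square_summable[OF x], of ?e] by simp
  also have "\<dots> = cinner ell2 x (?A (?K ?e))"
    by (intro cinner_kernel_operator x kernel_operator_square_summable square_summable_unit)
  also have "\<dots> = x l" unfolding AKe by simp
  finally show "?A (?K x) l = x l" .
qed

lemma unitary_kernel_operator:
  assumes columns: "\<And>l n. (\<Sum>\<^sub>\<infinity>m. cnj (k m l) * k m n) = (if l = n then 1 else 0)"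
    and rows: "\<And>l n. (\<Sum>\<^sub>\<infinity>m. k l m * cnj (k n m)) = (if l = n then 1 else 0)"
  shows "unitary ell2 (kernel_operator k)"
proof -
  interpret adj: schur_kernel "adjoint_kernel k" M by (rule schur_kernel_adjoint)
  have "opfun (kernel_operator k) (opfun (kernel_operator (adjoint_kernel k)) x) = x"
    if "x \<in> square_summable" for x
    using adj.adjoint_kernel_operator_left_inverse[OF _ that] rows
    by (simp add: adjoint_kernel_def[of k])
  then show ?thesis
    using kernel_operator_in_bounded_operators adjoint_kernel_operator_left_inverse[OF columns]
    by (auto simp: unitary_def op_eq_def op_le_def op_comp_def op_id_def
        opdom_adjoint_kernel_operator opfun_adjoint_kernel_operator kernel_operator_square_summable
        adj.kernel_operator_square_summable)
qed

end

section \<open>Laurent operators\<close>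

text \<open>Convolution with \<open>b\<close> on \<open>\<ell>\<^sup>2(\<int>)\<close>, transported to sequences indexed by natural numbers along the bijection
  \<open>int_decode\<close>.\<close>

definition laurent_kernel :: "(int \<Rightarrow> complex) \<Rightarrow> nat \<Rightarrow> nat \<Rightarrow> complex" where
  "laurent_kernel b m n = b (int_decode m - int_decode n)"

lemma bij_int_decode_minus: "bij (\<lambda>m. int_decode m - a)" "bij (\<lambda>m. a - int_decode m)"
proof -
  have "bij ((\<lambda>j. j - a) \<circ> int_decode)"
    by (rule bij_comp[OF bij_int_decode]) (rule bij_betwI[of _ _ _ "\<lambda>j. j + a"], auto)
  then show "bij (\<lambda>m. int_decode m - a)" by (simp add: o_def)
  have "bij ((\<lambda>j. a - j) \<circ> int_decode)"
    by (rule bij_comp[OF bij_int_decode]) (rule bij_betwI[of _ _ _ "\<lambda>j. a - j"], auto)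
  then show "bij (\<lambda>m. a - int_decode m)" by (simp add: o_def)
qed

lemmas infsum_int_decode_minus =
  infsum_reindex_bij_betw[OF bij_int_decode_minus(1)]
  infsum_reindex_bij_betw[OF bij_int_decode_minus(2)]

lemmas summable_on_int_decode_minus =
  summable_on_reindex_bij_betw[OF bij_int_decode_minus(1)]
  summable_on_reindex_bij_betw[OF bij_int_decode_minus(2)]

text \<open>Every row and every column is a rearrangement of \<open>b\<close>. The summand \<open>1\<close> only keeps the bound positive when \<open>b\<close>
  vanishes.\<close>

lemma schur_kernel_laurent:
  assumes "(\<lambda>j. cmod (b j)) summable_on UNIV"
  shows "schur_kernel (laurent_kernel b) (1 + (\<Sum>\<^sub>\<infinity>j. cmod (b j)))"
  unfolding laurent_kernel_def
  by unfold_locales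
    (simp_all add: assms summable_on_int_decode_minus[of "\<lambda>j. cmod (b j)"]
      infsum_int_decode_minus[of "\<lambda>j. cmod (b j)"] infsum_nonneg add_pos_nonneg)

text \<open>Gram matrices of columns and of rows are autocorrelations of \<open>b\<close>, up to complex conjugation.\<close>

lemma unitary_laurent_operator:
  assumes summable: "(\<lambda>j. cmod (b j)) summable_on UNIV"
    and orthonormal: "\<And>a. (\<Sum>\<^sub>\<infinity>j. b j * cnj (b (j + a))) = (if a = 0 then 1 else 0)"
  shows "unitary ell2 (kernel_operator (laurent_kernel b))"
proof -
  interpret schur_kernel "laurent_kernel b" "1 + (\<Sum>\<^sub>\<infinity>j. cmod (b j))"
    by (rule schur_kernel_laurent[OF summable])
  have orthonormal': "(\<Sum>\<^sub>\<infinity>j. cnj (b j) * b (j + a)) = (if a = 0 then 1 else 0)" for a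
    using arg_cong[OF orthonormal[of a], of cnj] by (simp flip: infsum_cnj)
  show ?thesis
  proof (rule unitary_kernel_operator)
    fix l n
    have "int_decode l = int_decode n \<longleftrightarrow> l = n"
      by (metis int_decode_inverse)
    then show "(\<Sum>\<^sub>\<infinity>m. cnj (laurent_kernel b m l) * laurent_kernel b m n) = (if l = n then 1 else 0)"
      using infsum_int_decode_minus(1)[of "\<lambda>j. cnj (b j) * b (j + (int_decode l - int_decode n))" "int_decode l"]
        orthonormal'[of "int_decode l - int_decode n"]
      by (simp add: laurent_kernel_def)
    from \<open>int_decode l = int_decode n \<longleftrightarrow> l = n\<close>
    show "(\<Sum>\<^sub>\<infinity>m. laurent_kernel b l m * cnj (laurent_kernel b n m)) = (if l = n then 1 else 0)"
      using infsum_int_decode_minus(2)[of "\<lambda>j. b j * cnj (b (j + (int_decode n - int_decode l)))" "int_decode l"]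
        orthonormal[of "int_decode n - int_decode l"]
      by (auto simp: laurent_kernel_def)
  qed
qed

section \<open>An elliptic symbol\<close>

text \<open>For odd \<open>j\<close> this is \<open>1 / (2 sinh (j ln 4))\<close>. Keeping only odd indices avoids the singularity at \<open>j = 0\<close> and makes
  all autocorrelations at odd shifts vanish term by term.\<close>

definition odd_csch :: "int \<Rightarrow> real" where
  "odd_csch j = (if odd j then 1 / (4 powi j - 4 powi (- j)) else 0)"

text \<open>The factor \<open>2\<^sup>j\<close> moves the annulus of convergence of the Laurent series from \<open>1/4 < |z| < 4\<close> to
  \<open>1/8 < |z| < 2\<close>, so that its outer boundary lies strictly between the circles of radius \<open>1\<close> and \<open>4\<close>.\<close>

definition symbol_coeff :: "int \<Rightarrow> real" where
  "symbol_coeff j = 2 powi j * odd_csch j"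

lemma odd_csch_uminus: "odd_csch (- j) = - odd_csch j"
proof -
  have "(1::real) / (4 powi (- j) - 4 powi j) = - (1 / (4 powi j - 4 powi (- j)))"
    by (metis minus_diff_eq minus_divide_right)
  then show ?thesis by (simp only: odd_csch_def even_minus minus_minus if_distrib[of uminus] minus_zero)
qed

lemma odd_csch_nat_bounds:
  assumes "odd n"
  shows "1 / 4 ^ n \<le> odd_csch (int n)" "odd_csch (int n) \<le> 2 / 4 ^ n"
proof -
  have "n \<ge> 1" using assms by (cases n) auto
  then have "(4::real) ^ 1 \<le> 4 ^ n" by (intro power_increasing) auto
  then have X: "(4::real) ^ n \<ge> 4" by simp
  then have inv: "0 < 1 / (4::real) ^ n" "1 / (4::real) ^ n \<le> 1"
    by (auto simp: divide_le_eq_1)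
  have eq: "odd_csch (int n) = 1 / (4 ^ n - 1 / 4 ^ n)"
    using assms by (simp add: odd_csch_def power_int_minus divide_inverse)
  show "1 / 4 ^ n \<le> odd_csch (int n)"
    unfolding eq using X inv by (intro divide_left_mono mult_pos_pos) linarith+
  have "1 / (4 ^ n - 1 / 4 ^ n) \<le> 1 / ((4::real) ^ n / 2)"
    using X inv by (intro divide_left_mono mult_pos_pos) linarith+
  then show "odd_csch (int n) \<le> 2 / 4 ^ n"
    unfolding eq by simp
qed

lemma abs_odd_csch_le: "\<bar>odd_csch j\<bar> \<le> 2 * (1 / 4) ^ nat \<bar>j\<bar>"
proof -
  have nat: "\<bar>odd_csch (int n)\<bar> \<le> 2 * (1 / 4) ^ n" for n
  proof (cases "odd n")
    case True
    have "0 \<le> 1 / (4::real) ^ n" by simp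
    with odd_csch_nat_bounds[OF True] show ?thesis
      by (simp add: power_one_over abs_le_iff)
  qed (simp add: odd_csch_def)
  show ?thesis
  proof (cases j rule: int_cases2)
    case (nonneg n)
    then show ?thesis using nat by simp
  next
    case (nonpos n)
    then show ?thesis using nat[of n] by (simp add: odd_csch_uminus)
  qed
qed

text \<open>The decay rates \<open>2\<^sup>-\<^sup>j\<close> for \<open>j \<rightarrow> \<infinity>\<close> and \<open>8\<^sup>j\<close> for \<open>j \<rightarrow> -\<infinity>\<close> differ; the slower one bounds both
  sides.\<close>

lemma abs_symbol_coeff_le: "\<bar>symbol_coeff j\<bar> \<le> 2 * (1 / 2) ^ nat \<bar>j\<bar>"
proof -
  have "(2::real) powi j \<le> 2 powi \<bar>j\<bar>"
    by (intro power_int_increasing) auto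
  also have "\<dots> = 2 ^ nat \<bar>j\<bar>"
    by (simp add: power_int_def)
  finally have "\<bar>symbol_coeff j\<bar> \<le> 2 ^ nat \<bar>j\<bar> * (2 * (1 / 4) ^ nat \<bar>j\<bar>)"
    unfolding symbol_coeff_def abs_mult
    by (intro mult_mono abs_odd_csch_le) auto
  also have "\<dots> = 2 * (2 * (1 / 4)) ^ nat \<bar>j\<bar>"
    by (simp only: power_mult_distrib mult_ac)
  finally show ?thesis by simp
qed

lemma summable_on_power_abs_int:
  fixes q :: real
  assumes "0 \<le> q" "q < 1"
  shows "(\<lambda>j::int. q ^ nat \<bar>j\<bar>) summable_on UNIV"
proof -
  have geo: "(\<lambda>n. q ^ n) summable_on UNIV"
    using assms by (intro summable_nonneg_imp_summable_on summable_geometric) auto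
  have "(\<lambda>j::int. q ^ nat \<bar>j\<bar>) summable_on range int"
    using geo by (subst summable_on_reindex) (auto simp: o_def)
  moreover have "(\<lambda>j::int. q ^ nat \<bar>j\<bar>) summable_on range (\<lambda>n. - int n)"
    using geo by (subst summable_on_reindex) (auto simp: o_def inj_def)
  ultimately have "(\<lambda>j::int. q ^ nat \<bar>j\<bar>) summable_on range int \<union> range (\<lambda>n. - int n)"
    by (rule summable_on_union)
  moreover have "range int \<union> range (\<lambda>n. - int n) = UNIV"
    by (auto intro: int_cases2)
  ultimately show ?thesis by simp
qed

lemma summable_on_odd_csch: "odd_csch summable_on UNIV"
proof -
  have "(\<lambda>j. norm (odd_csch j)) summable_on UNIV"
    by (rule summable_on_comparison_test[OF
          summable_on_cmult_right[OF summable_on_power_abs_int[of "1 / 4"], of 2]])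
      (use abs_odd_csch_le in auto)
  then show ?thesis by (rule abs_summable_summable)
qed

lemma abs_summable_on_symbol_coeff: "(\<lambda>j. \<bar>symbol_coeff j\<bar>) summable_on UNIV"
  by (rule summable_on_comparison_test[OF
        summable_on_cmult_right[OF summable_on_power_abs_int[of "1 / 2"], of 2]])
    (use abs_symbol_coeff_le in auto)

lemma has_sum_odd_csch: "(odd_csch has_sum 0) UNIV"
proof -
  have "bij (uminus :: int \<Rightarrow> int)"
    by (rule bij_betwI[of _ _ _ uminus]) auto
  from infsum_reindex_bij_betw[OF this, of odd_csch] have "infsum odd_csch UNIV = 0"
    by (simp add: odd_csch_uminus infsum_uminus)
  then show ?thesis
    using has_sum_infsum[OF summable_on_odd_csch] by simp
qed

text \<open>With \<open>A = 4\<^sup>j\<close> and \<open>K = 4\<^sup>a\<close>, and for odd \<open>j\<close>, this is the partial fraction decomposition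
  \<open>A\<^sup>2 / ((A\<^sup>2 - 1) (A\<^sup>2 K\<^sup>2 - 1)) = (1 / (A\<^sup>2 - 1) - 1 / (A\<^sup>2 K\<^sup>2 - 1)) / (K\<^sup>2 - 1)\<close>
  multiplied by \<open>A K\<close>: the factor \<open>4\<^sup>j\<close> coming from \<open>2\<^sup>j 2\<^sup>j\<^sup>+\<^sup>a\<close> is what turns both terms on the right back into
  values of \<open>odd_csch\<close>.\<close>

lemma symbol_coeff_telescope:
  assumes "even a" "a \<noteq> 0"
  shows "symbol_coeff j * symbol_coeff (j + a)
    = 2 powi a / (16 powi a - 1) * (4 powi a * odd_csch j - odd_csch (j + a))"
proof (cases "odd j")
  case False
  with assms show ?thesis by (simp add: symbol_coeff_def odd_csch_def)
next
  case True
  define A K :: real where "A = 4 powi j" and "K = 4 powi a"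
  have pos: "A > 0" "K > 0" by (simp_all add: A_def K_def)
  have ne1: "(16::real) powi i \<noteq> 1" if "i \<noteq> 0" for i
    using that power_int_strict_increasing[of i 0 "16::real"] power_int_strict_increasing[of 0 i "16::real"]
    by (cases "i < 0") auto
  have sq: "(16::real) powi i = (4 powi i)\<^sup>2" for i
    by (simp add: power2_eq_square flip: power_int_mult_distrib)
  have "j \<noteq> 0" "j + a \<noteq> 0"
    using True assms(1) even_add[of j a] by (metis even_zero)+
  then have ne: "A\<^sup>2 - 1 \<noteq> 0" "(A * K)\<^sup>2 - 1 \<noteq> 0" "K\<^sup>2 - 1 \<noteq> 0"
    using ne1[of j] ne1[of "j + a"] ne1[OF assms(2)]
    by (auto simp: sq A_def K_def power_int_add)
  have csch: "odd_csch i = 4 powi i / ((4 powi i)\<^sup>2 - 1)" if "odd i" for i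
  proof -
    define X :: real where "X = 4 powi i"
    have "X > 0" by (simp add: X_def)
    then have "X - inverse X = (X\<^sup>2 - 1) / X"
      by (simp add: field_simps power2_eq_square)
    then show ?thesis
      using that by (simp add: odd_csch_def power_int_minus flip: X_def)
  qed
  have w: "odd_csch j = A / (A\<^sup>2 - 1)" "odd_csch (j + a) = A * K / ((A * K)\<^sup>2 - 1)"
    using csch[OF True] csch[of "j + a"] True assms(1)
    by (simp_all add: A_def K_def power_int_add)
  have two: "(2::real) powi j * 2 powi (j + a) = A * 2 powi a"
    by (simp add: A_def power_int_add flip: power_int_mult_distrib)
  have "A * (odd_csch j * odd_csch (j + a)) * (K\<^sup>2 - 1) = K * odd_csch j - odd_csch (j + a)"
  proof -
    define D E where "D = A\<^sup>2 - 1" and "E = (A * K)\<^sup>2 - 1"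
    have "A * (A / D * (A * K / E)) * (K\<^sup>2 - 1) = A * K * (A\<^sup>2 * (K\<^sup>2 - 1)) / (D * E)"
      by (simp add: power2_eq_square)
    also have "A\<^sup>2 * (K\<^sup>2 - 1) = E - D"
      by (simp add: D_def E_def power_mult_distrib right_diff_distrib)
    also have "A * K * (E - D) / (D * E) = K * (A / D) - A * K / E"
      using ne(1,2) unfolding D_def[symmetric] E_def[symmetric] by (simp add: field_simps)
    finally show ?thesis
      unfolding w D_def E_def .
  qed
  then have "A * (odd_csch j * odd_csch (j + a)) = (K * odd_csch j - odd_csch (j + a)) / (K\<^sup>2 - 1)"
    using ne(3) by (simp add: eq_divide_eq)
  then have "2 powi a * (A * (odd_csch j * odd_csch (j + a)))
      = 2 powi a / (K\<^sup>2 - 1) * (K * odd_csch j - odd_csch (j + a))"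
    by simp
  moreover have "symbol_coeff j * symbol_coeff (j + a)
      = 2 powi a * (A * (odd_csch j * odd_csch (j + a)))"
    unfolding symbol_coeff_def using two by (metis mult.assoc mult.commute mult.left_commute)
  ultimately show ?thesis
    by (simp add: sq K_def)
qed

text \<open>Both terms of the partial fraction decomposition sum to zero because \<open>odd_csch\<close> is an odd function.\<close>

lemma has_sum_symbol_correlation:
  assumes "a \<noteq> 0"
  shows "((\<lambda>j. symbol_coeff j * symbol_coeff (j + a)) has_sum 0) UNIV"
proof (cases "even a")
  case False
  then have "symbol_coeff j * symbol_coeff (j + a) = 0" for j
    by (simp add: symbol_coeff_def odd_csch_def)
  then show ?thesis by (simp only: has_sum_0_simp)
next
  case True
  have "bij (\<lambda>j. j + a)"
    by (rule bij_betwI[of _ _ _ "\<lambda>j. j - a"]) auto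
  then have shift: "((\<lambda>j. odd_csch (j + a)) has_sum 0) UNIV"
    using has_sum_odd_csch has_sum_reindex_bij_betw[of "\<lambda>j. j + a" UNIV UNIV odd_csch 0] by blast
  have "((\<lambda>j. 2 powi a / (16 powi a - 1) * (4 powi a * odd_csch j + - odd_csch (j + a)))
      has_sum 2 powi a / (16 powi a - 1) * (4 powi a * 0 + - 0)) UNIV"
    using has_sum_odd_csch shift
    by (intro has_sum_cmult_right has_sum_add has_sum_uminusI)
  then show ?thesis
    unfolding symbol_coeff_telescope[OF True assms] by simp
qed

definition symbol_norm :: real where
  "symbol_norm = sqrt (\<Sum>\<^sub>\<infinity>j. (symbol_coeff j)\<^sup>2)"

lemma summable_on_symbol_coeff_square: "(\<lambda>j. (symbol_coeff j)\<^sup>2) summable_on UNIV"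
proof (rule summable_on_comparison_test)
  show "(\<lambda>j. 2 * \<bar>symbol_coeff j\<bar>) summable_on UNIV"
    by (rule summable_on_cmult_right[OF abs_summable_on_symbol_coeff])
  show "(symbol_coeff j)\<^sup>2 \<le> 2 * \<bar>symbol_coeff j\<bar>" for j
  proof -
    have "(1 / 2 :: real) ^ nat \<bar>j\<bar> \<le> 1" by (rule power_le_one) auto
    then have "\<bar>symbol_coeff j\<bar> \<le> 2" using abs_symbol_coeff_le[of j] by linarith
    then have "\<bar>symbol_coeff j\<bar> * \<bar>symbol_coeff j\<bar> \<le> 2 * \<bar>symbol_coeff j\<bar>"
      by (intro mult_right_mono) auto
    then show ?thesis by (simp add: power2_eq_square)
  qed
qed simp

lemma symbol_norm_pos: "0 < symbol_norm"
proof -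
  have "0 < (\<Sum>j\<in>{1}. (symbol_coeff j)\<^sup>2)"
    by (simp add: symbol_coeff_def odd_csch_def)
  also have "\<dots> \<le> (\<Sum>\<^sub>\<infinity>j. (symbol_coeff j)\<^sup>2)"
    by (rule finite_sum_le_infsum[OF summable_on_symbol_coeff_square]) auto
  finally show ?thesis by (simp add: symbol_norm_def)
qed

text \<open>Since \<open>odd_csch\<close> is odd, the factor \<open>\<i>\<close> is needed for \<open>4\<^sup>j cnj b\<^sub>-\<^sub>j\<close> to equal \<open>b\<^sub>j\<close> rather than
  \<open>- b\<^sub>j\<close>.\<close>

definition symbol :: "int \<Rightarrow> complex" where
  "symbol j = \<i> * complex_of_real (symbol_coeff j / symbol_norm)"

lemma cmod_symbol: "cmod (symbol j) = \<bar>symbol_coeff j\<bar> / symbol_norm"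
  using symbol_norm_pos by (simp add: symbol_def norm_mult del: of_real_divide)

lemma summable_on_cmod_symbol: "(\<lambda>j. cmod (symbol j)) summable_on UNIV"
  unfolding cmod_symbol divide_inverse
  by (rule summable_on_cmult_left[OF abs_summable_on_symbol_coeff])

lemma symbol_orthonormal:
  "(\<Sum>\<^sub>\<infinity>j. symbol j * cnj (symbol (j + a))) = (if a = 0 then 1 else 0)"
proof -
  have N: "symbol_norm\<^sup>2 = (\<Sum>\<^sub>\<infinity>j. (symbol_coeff j)\<^sup>2)"
    by (simp add: symbol_norm_def infsum_nonneg)
  have "((\<lambda>j. symbol_coeff j * symbol_coeff (j + a)) has_sum (if a = 0 then symbol_norm\<^sup>2 else 0)) UNIV"
    using has_sum_symbol_correlation[of a] has_sum_infsum[OF summable_on_symbol_coeff_square]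
    unfolding N by (auto simp: power2_eq_square)
  then have "((\<lambda>j. symbol_coeff j * symbol_coeff (j + a) * (1 / symbol_norm\<^sup>2))
      has_sum ((if a = 0 then symbol_norm\<^sup>2 else 0) * (1 / symbol_norm\<^sup>2))) UNIV"
    by (rule has_sum_cmult_left)
  then have "((\<lambda>j. symbol_coeff j * symbol_coeff (j + a) * (1 / symbol_norm\<^sup>2))
      has_sum (if a = 0 then 1 else 0)) UNIV"
    using symbol_norm_pos by (auto split: if_splits)
  from has_sum_of_real[OF this, where 'a = complex]
  have "((\<lambda>j. complex_of_real (symbol_coeff j * symbol_coeff (j + a) * (1 / symbol_norm\<^sup>2)))
      has_sum (if a = 0 then 1 else 0)) UNIV"
    by (simp split: if_splits)
  moreover have "complex_of_real (symbol_coeff j * symbol_coeff (j + a) * (1 / symbol_norm\<^sup>2))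
      = symbol j * cnj (symbol (j + a))" for j
    by (simp add: complex_eq_iff symbol_def power2_eq_square del: of_real_divide)
  ultimately have "((\<lambda>j. symbol j * cnj (symbol (j + a))) has_sum (if a = 0 then 1 else 0)) UNIV"
    by simp
  then show ?thesis by (rule infsumI)
qed

text \<open>The coefficients on the left are those of \<open>(1 / \<beta>)(4 z)\<close>, where \<open>\<beta>\<close> is the function with Laurent coefficients
  \<open>symbol\<close>, because conjugation on the unit circle reverses the index.\<close>

lemma four_powi_symbol_uminus: "4 powi j * cnj (symbol (- j)) = symbol j"
proof -
  have "(4::real) powi j = 2 powi j * 2 powi j"
    by (simp flip: power_int_mult_distrib)
  then have "(4::real) powi j * symbol_coeff (- j) = - symbol_coeff j"
    by (simp add: symbol_coeff_def odd_csch_uminus power_int_minus)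
  from arg_cong[OF this, of complex_of_real]
  have eq: "4 powi j * complex_of_real (symbol_coeff (- j)) = - complex_of_real (symbol_coeff j)"
    by simp
  have "4 powi j * cnj (symbol (- j))
      = - \<i> * (4 powi j * complex_of_real (symbol_coeff (- j))) / complex_of_real symbol_norm"
    by (simp add: symbol_def mult_ac)
  then show ?thesis
    unfolding eq by (simp add: symbol_def)
qed

text \<open>Along odd positive \<open>j\<close> the coefficients are of exact order \<open>2\<^sup>-\<^sup>j\<close>, so the weight \<open>4\<^sup>j\<close> makes the terms
  unbounded.\<close>

lemma four_powi_symbol_not_square_summable:
  "\<not> (\<lambda>j. (cmod (4 powi j * symbol j))\<^sup>2) summable_on UNIV"
proof
  assume S: "(\<lambda>j. (cmod (4 powi j * symbol j))\<^sup>2) summable_on UNIV"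
  define c where "c = (\<Sum>\<^sub>\<infinity>j. (cmod (4 powi j * symbol j))\<^sup>2)"
  have bound: "2 ^ n \<le> sqrt c * symbol_norm" if "odd n" for n
  proof -
    have "(\<Sum>j\<in>{int n}. (cmod (4 powi j * symbol j))\<^sup>2) \<le> c"
      unfolding c_def by (rule finite_sum_le_infsum[OF S]) auto
    then have "cmod (4 powi int n * symbol (int n)) \<le> sqrt c"
      by (simp add: real_le_rsqrt)
    moreover have "cmod (4 powi int n * symbol (int n)) = 4 ^ n * (2 ^ n * \<bar>odd_csch (int n)\<bar> / symbol_norm)"
      by (simp add: norm_mult cmod_symbol symbol_coeff_def abs_mult norm_power)
    ultimately have "4 ^ n * (2 ^ n * \<bar>odd_csch (int n)\<bar> / symbol_norm) \<le> sqrt c"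
      by simp
    then have "4 ^ n * (2 ^ n * \<bar>odd_csch (int n)\<bar>) \<le> sqrt c * symbol_norm"
      using symbol_norm_pos by (simp add: field_simps)
    moreover have "1 \<le> 4 ^ n * \<bar>odd_csch (int n)\<bar>"
      using order_trans[OF odd_csch_nat_bounds(1)[OF that] abs_ge_self] by (simp add: field_simps)
    then have "2 ^ n * 1 \<le> 2 ^ n * (4 ^ n * \<bar>odd_csch (int n)\<bar>)"
      by (intro mult_left_mono) auto
    ultimately show ?thesis by (metis mult.left_commute mult_1_right order_trans)
  qed
  obtain n where n: "sqrt c * symbol_norm < 2 ^ n"
    using real_arch_pow[of 2 "sqrt c * symbol_norm"] by auto
  also have "(2::real) ^ n \<le> 2 ^ (2 * n + 1)"
    by (intro power_increasing) auto
  finally show False using bound[of "2 * n + 1"] by simp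
qed

section \<open>A unitary operator intertwining in one direction only\<close>

theorem proposition2p6:
  shows "\<exists>(H :: (nat \<Rightarrow> complex) cinner_space) B T.
    complex_hilbert_space H \<and>
    B \<in> bounded_operators H \<and> unitary H B \<and>
    self_adjoint H T \<and>
    op_le (op_comp B T) (op_comp T (op_adjoint H B)) \<and>
    \<not> op_le (op_comp (op_adjoint H B) T) (op_comp T B)"
proof -
  define k where "k = laurent_kernel symbol"
  define t :: "nat \<Rightarrow> real" where "t = (\<lambda>n. 4 powi int_decode n)"
  let ?B = "kernel_operator k" and ?T = "multiplication_operator t"
  let ?A = "op_adjoint ell2 ?B"
  interpret schur_kernel k "1 + (\<Sum>\<^sub>\<infinity>j. cmod (symbol j))"
    unfolding k_def by (rule schur_kernel_laurent[OF summable_on_cmod_symbol])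
  have "unitary ell2 ?B"
    unfolding k_def by (rule unitary_laurent_operator[OF summable_on_cmod_symbol symbol_orthonormal])

  \<comment> \<open>The matrix entries of \<open>T B\<^sup>*\<close> and \<open>B T\<close> agree; this is the symmetry of the symbol at
      \<open>j = int_decode m - int_decode n\<close>.\<close>
  have kernel: "complex_of_real (t m) * adjoint_kernel k m n = k m n * complex_of_real (t n)" for m n
  proof -
    let ?p = "int_decode m" and ?q = "int_decode n"
    have "complex_of_real (t m) = 4 powi ?q * 4 powi (?p - ?q)"
      by (simp add: t_def flip: power_int_add)
    then show ?thesis
      using four_powi_symbol_uminus[of "?p - ?q"]
      by (simp add: k_def adjoint_kernel_def laurent_kernel_def t_def mult_ac)
  qed
  \<comment> \<open>An identity of families that need not be square summable, hence stated for every \<open>x\<close> in the space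
      and not only for the domain of \<open>T\<close>.\<close>
  have TA: "opfun ?T (opfun ?A x) = opfun ?B (opfun ?T x)" if "x \<in> square_summable" for x
    unfolding opfun_adjoint_kernel_operator[OF that]
    by (simp add: multiplication_operator_def kernel_operator_def kernel
        flip: infsum_cmult_right' mult.assoc)
  have BT: "op_le (op_comp ?B ?T) (op_comp ?T ?A)"
    unfolding op_le_def
  proof (intro conjI subsetI ballI)
    fix x assume "x \<in> opdom (op_comp ?B ?T)"
    then have x: "x \<in> square_summable" "opfun ?T x \<in> square_summable"
      by (auto simp: op_comp_def multiplication_operator_def)
    have "opfun ?A x \<in> square_summable"
      using opfun_adjoint_kernel_operator[OF x(1)]
        schur_kernel.kernel_operator_square_summable[OF schur_kernel_adjoint x(1)] by simp
    moreover have "opfun ?T (opfun ?A x) \<in> square_summable"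
      unfolding TA[OF x(1)] by (rule kernel_operator_square_summable[OF x(2)])
    ultimately have "opfun ?A x \<in> opdom ?T"
      by (simp add: multiplication_operator_def)
    then show "x \<in> opdom (op_comp ?T ?A)"
      using x(1) by (simp add: op_comp_def opdom_adjoint_kernel_operator)
    show "opfun (op_comp ?B ?T) x = opfun (op_comp ?T ?A) x"
      using TA[OF x(1)] by (simp add: op_comp_def)
  qed

  \<comment> \<open>The unit vector at the integer \<open>0\<close>, which \<open>B\<close> maps to the sequence of coefficients of the symbol.\<close>
  let ?e = "\<lambda>i :: nat. if i = int_encode 0 then 1 else 0 :: complex"
  have "?e \<in> opdom (op_comp ?A ?T)"
    using unit_in_multiplication_domain[of "int_encode 0" t]
    by (simp add: op_comp_def opdom_adjoint_kernel_operator)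
      (simp add: multiplication_operator_def)
  moreover have "?e \<notin> opdom (op_comp ?T ?B)"
  proof
    assume "?e \<in> opdom (op_comp ?T ?B)"
    then have "opfun ?B ?e \<in> opdom ?T" by (simp add: op_comp_def)
    then have "(\<lambda>m. (cmod (4 powi int_decode m * symbol (int_decode m)))\<^sup>2) summable_on UNIV"
      unfolding kernel_operator_unit
      by (simp add: multiplication_operator_def square_summable_def t_def k_def laurent_kernel_def)
    then show False
      using four_powi_symbol_not_square_summable
        summable_on_reindex_bij_betw[OF bij_int_decode, of "\<lambda>j. (cmod (4 powi j * symbol j))\<^sup>2"] by simp
  qed
  ultimately have "\<not> op_le (op_comp ?A ?T) (op_comp ?T ?B)"
    unfolding op_le_def by blast
  with \<open>unitary ell2 ?B\<close> BT show ?thesis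
    using complex_hilbert_space_ell2 kernel_operator_in_bounded_operators
      self_adjoint_multiplication_operator by blast
qed

end
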